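(* Let $m,n$ be positive integers and $a,b$ non-negative integers with $a+b=n$. Let $x_1,\ldots,x_a,y_1,\ldots,y_b$ be complex numbers with $x_1+\cdots+x_a+y_1+\cdots+y_b=0$. Define \[ R_{3,4}(m,n;\tau)= mn\sum_{\substack{r_1,\ldots,r_a,s_1,\ldots,s_b\in\mathbb{Z}\\ r_1+\cdots+r_a+s_1+\cdots+s_b=0}}(-1)^{s_1+\cdots+s_b}q^{r_1^2+\cdots+r_a^2+s_1^2+\cdots+s_b^2}e^{2i(r_1x_1+\cdots+r_ax_a+s_1y_1+\cdots+s_by_b)}. \] Let $S(z)=\sum_{k=0}^{mn-1}\prod_{j=1}^{a}\vartheta_3\!\left(z+x_j+\tfrac{k\pi}{mn}\Big|\tau\right)\prod_{i=1}^{b}\vartheta_4\!\left(z+y_i+\tfrac{k\pi}{mn}\Big|\tau\right)$. Then for all $z\in\mathbb{C}$: if $mb$ is even, $S(z)=R_{3,4}(m,n;\tau)\,\vartheta_3(mnz\,|\,m^2n\tau)$; if $mb$ is odd, $S(z)=R_{3,4}(m,n;\tau)\,\vartheta_4(mnz\,|\,m^2n\tau)$.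
   Context: Throughout, $\tau\in\mathbb{C}$ with $\Im(\tau)>0$, $q=e^{\pi i\tau}$, and $q^{\alpha}$ means $e^{\pi i\alpha\tau}$ for real $\alpha$. The Jacobi theta functions are $\vartheta_3(z|\tau)=\sum_{n\in\mathbb{Z}}q^{n^2}e^{2niz}$, $\vartheta_4(z|\tau)=\sum_{n\in\mathbb{Z}}(-1)^nq^{n^2}e^{2niz}$; and $\vartheta_j(z|m^2n\tau)$ denotes the same function with $\tau$ replaced by $m^2n\tau$. An empty product equals $1$. *)

theory Defs
  imports "HOL-Analysis.Analysis"
begin

text \<open>With \<open>q = exp (\<pi> \<i> \<tau>)\<close>, \<open>nome_pow \<tau> \<alpha>\<close> is \<open>q\<close> to the power \<open>\<alpha>\<close>, read as
  \<open>exp (\<pi> \<i> \<alpha> \<tau>)\<close>, so that no branch of the logarithm enters.\<close>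

definition nome_pow :: "complex \<Rightarrow> real \<Rightarrow> complex" where
  "nome_pow \<tau> \<alpha> = exp (of_real pi * \<i> * of_real \<alpha> * \<tau>)"

definition theta3 :: "complex \<Rightarrow> complex \<Rightarrow> complex" where
  "theta3 z \<tau> = (\<Sum>\<^sub>\<infinity>n\<in>(UNIV :: int set).
     nome_pow \<tau> (of_int (n\<^sup>2)) * exp (2 * of_int n * \<i> * z))"

definition theta4 :: "complex \<Rightarrow> complex \<Rightarrow> complex" where
  "theta4 z \<tau> = (\<Sum>\<^sub>\<infinity>n\<in>(UNIV :: int set).
     (-1) powi n * nome_pow \<tau> (of_int (n\<^sup>2)) * exp (2 * of_int n * \<i> * z))"

text \<open>Integer tuples of length \<open>a\<close> are extensional functions on \<open>{1..a}\<close>, so that each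
  tuple is counted exactly once in the infinite sum \<open>R34\<close>.\<close>

definition zero_sum_tuples :: "nat \<Rightarrow> nat \<Rightarrow> ((nat \<Rightarrow> int) \<times> (nat \<Rightarrow> int)) set" where
  "zero_sum_tuples a b =
     {(r, s). r \<in> {1..a} \<rightarrow>\<^sub>E UNIV \<and> s \<in> {1..b} \<rightarrow>\<^sub>E UNIV \<and>
              (\<Sum>j=1..a. r j) + (\<Sum>i=1..b. s i) = 0}"

definition R34 :: "nat \<Rightarrow> nat \<Rightarrow> nat \<Rightarrow> nat \<Rightarrow> (nat \<Rightarrow> complex) \<Rightarrow> (nat \<Rightarrow> complex) \<Rightarrow> complex \<Rightarrow> complex"
  where
  "R34 m n a b x y \<tau> = of_nat (m * n) *
     (\<Sum>\<^sub>\<infinity>(r, s)\<in>zero_sum_tuples a b.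
        (-1) powi (\<Sum>i=1..b. s i)
        * nome_pow \<tau> (of_int ((\<Sum>j=1..a. (r j)\<^sup>2) + (\<Sum>i=1..b. (s i)\<^sup>2)))
        * exp (2 * \<i> * ((\<Sum>j=1..a. of_int (r j) * x j) + (\<Sum>i=1..b. of_int (s i) * y i))))"

definition S34 :: "nat \<Rightarrow> nat \<Rightarrow> nat \<Rightarrow> nat \<Rightarrow> (nat \<Rightarrow> complex) \<Rightarrow> (nat \<Rightarrow> complex) \<Rightarrow> complex \<Rightarrow> complex \<Rightarrow> complex"
  where
  "S34 m n a b x y \<tau> z =
     (\<Sum>k<m * n.
        (\<Prod>j=1..a. theta3 (z + x j + of_nat k * of_real pi / of_nat (m * n)) \<tau>)
      * (\<Prod>i=1..b. theta4 (z + y i + of_nat k * of_real pi / of_nat (m * n)) \<tau>))"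

end

theory Submission
  imports Defs
begin

text \<open>
  Since \<open>\<vartheta>\<^sub>4(z) = \<vartheta>\<^sub>3(z + \<pi>/2)\<close>, it suffices to treat products of \<open>n\<close> functions \<open>\<vartheta>\<^sub>3(z + w\<^sub>i)\<close> with
  arbitrary \<open>w\<^sub>i\<close>. Expand such a product into an absolutely convergent sum over tuples \<open>t \<in> \<int>\<^sup>n\<close>;
  averaging over the translates by \<open>k\<pi>/(mn)\<close> keeps exactly the tuples with \<open>\<Sum>t = mnl\<close>, \<open>l \<in> \<int>\<close>.
  Subtracting \<open>ml\<close> from every entry makes the sum zero and, as the cross term \<open>2ml\<Sum>t\<close> vanishes,
  splits the summand into a zero-sum factor and the \<open>l\<close>-th term of
  \<open>\<vartheta>\<^sub>3(mnz + m\<Sum>w | m\<^sup>2n\<tau>)\<close>. Here \<open>m\<Sum>w = mb\<pi>/2\<close>, and the parity of \<open>mb\<close> decides between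
  \<open>\<vartheta>\<^sub>3\<close> and \<open>\<vartheta>\<^sub>4\<close>.
\<close>

section \<open>Absolute convergence of products and of the theta series\<close>

text \<open>Induction on \<open>I\<close>: a new index turns \<open>PiE\<close> into the image of a
  binary product, where rows and row sums of norms are scalar multiples of summable
  families.\<close>

lemma abs_summable_on_prod_PiE:
  fixes f :: "'i \<Rightarrow> 'b \<Rightarrow> 'c :: {real_normed_field, banach}"
  assumes "finite I" and "\<And>i. i \<in> I \<Longrightarrow> (\<lambda>n. norm (f i n)) summable_on B i"
  shows "(\<lambda>t. norm (\<Prod>i\<in>I. f i (t i))) summable_on PiE I B"
  using assms
proof (induction I rule: finite_induct)
  case empty
  then show ?case by simp
next
  case (insert x A)
  have pi: "PiE (insert x A) B = (\<lambda>(y, g). g(x := y)) ` (B x \<times> PiE A B)"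
    by (simp add: PiE_insert_eq)
  have inj: "inj_on (\<lambda>(y, g). g(x := y)) (B x \<times> PiE A B)"
    by (rule inj_combinator[OF insert.hyps(2)])
  have prod: "(\<Prod>i\<in>A. f i ((g(x := y)) i)) = (\<Prod>i\<in>A. f i (g i))" for g y
    by (rule prod.cong) (use insert.hyps in auto)
  have "(\<lambda>g. norm (\<Prod>i\<in>A. f i (g i))) summable_on PiE A B"
    using insert by simp
  moreover have "(\<lambda>n. norm (f x n)) summable_on B x"
    using insert by simp
  ultimately have "(\<lambda>p. norm (case p of (y, g) \<Rightarrow> f x y * (\<Prod>i\<in>A. f i (g i)))) summable_on B x \<times> PiE A B"
    unfolding Infinite_Sum.abs_summable_on_Sigma_iff
    by (auto simp: norm_mult infsum_cmult_right' abs_mult intro!: summable_on_cmult_right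
        summable_on_cmult_left infsum_nonneg)
  then show ?case
    unfolding pi summable_on_reindex[OF inj]
    using insert.hyps by (simp add: o_def case_prod_unfold prod[simplified])
qed

lemma summable_on_power_abs_int:
  fixes c :: real
  assumes "0 \<le> c" "c < 1"
  shows "(\<lambda>n::int. c ^ nat \<bar>n\<bar>) summable_on UNIV"
proof -
  have geo: "(\<lambda>n::nat. c ^ n) summable_on UNIV"
    using assms by (auto simp: summable_on_UNIV_nonneg_real_iff)
  have "(\<lambda>n::int. c ^ nat \<bar>n\<bar>) summable_on range int"
    by (subst summable_on_reindex) (use geo in \<open>auto simp: o_def\<close>)
  moreover have "(\<lambda>n::int. c ^ nat \<bar>n\<bar>) summable_on range (\<lambda>k. - int k)"
    by (subst summable_on_reindex) (use geo in \<open>auto simp: o_def inj_on_def\<close>)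
  \<comment> \<open>The two halves overlap in 0, which is harmless for summability.\<close>
  moreover have "range int \<union> range (\<lambda>k. - int k) = UNIV"
    by (auto intro: int_cases2)
  ultimately show ?thesis
    by (metis summable_on_union)
qed

text \<open>The Gaussian decay of the nome beats the exponential growth in \<open>z\<close>; a
  geometric series in \<open>\<bar>n\<bar>\<close> is the majorant.\<close>

lemma abs_summable_on_theta3:
  assumes "Im \<tau> > 0"
  shows "(\<lambda>n. norm (nome_pow \<tau> (of_int (n\<^sup>2)) * exp (2 * of_int n * \<i> * z)))
    summable_on (UNIV :: int set)"
proof (rule Infinite_Sum.abs_summable_on_comparison_test')
  define A where "A = pi * Im \<tau>"
  \<comment> \<open>The summand 1 leaves a surplus factor \<open>exp (- t)\<close> once the growth
    \<open>2 * t * \<bar>Im z\<bar>\<close> is absorbed.\<close>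
  define B where "B = 2 * \<bar>Im z\<bar> + 1"
  have A: "A > 0"
    using assms by (simp add: A_def)
  show "(\<lambda>n::int. exp (B\<^sup>2 / (4 * A)) * exp (-1) ^ nat \<bar>n\<bar>) summable_on UNIV"
    by (intro summable_on_cmult_right summable_on_power_abs_int) auto
  fix n :: int
  define t where "t = \<bar>real_of_int n\<bar>"
  have t: "exp (-1) ^ nat \<bar>n\<bar> = exp (- t)"
    by (simp add: t_def flip: exp_of_nat_mult)
  have "- (2 * real_of_int n * Im z) \<le> 2 * t * \<bar>Im z\<bar>"
    using abs_ge_minus_self[of "real_of_int n * Im z"] by (simp add: t_def abs_mult mult_ac)
  moreover have "B * t \<le> A * t\<^sup>2 + B\<^sup>2 / (4 * A)"
  proof -
    have "0 \<le> (2 * A * t - B)\<^sup>2 / (4 * A)"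
      using A by simp
    also have "\<dots> = A * t\<^sup>2 + B\<^sup>2 / (4 * A) - B * t"
      using A by (simp add: field_simps power2_eq_square)
    finally show ?thesis by simp
  qed
  ultimately have "- A * t\<^sup>2 - 2 * real_of_int n * Im z \<le> B\<^sup>2 / (4 * A) - t"
    by (simp add: B_def algebra_simps)
  then have "exp (- A * t\<^sup>2 - 2 * real_of_int n * Im z) \<le> exp (B\<^sup>2 / (4 * A)) * exp (- t)"
    by (simp flip: exp_add)
  moreover have "norm (nome_pow \<tau> (of_int (n\<^sup>2)) * exp (2 * of_int n * \<i> * z))
      = exp (- A * t\<^sup>2 - 2 * real_of_int n * Im z)"
    by (simp add: nome_pow_def norm_mult A_def t_def flip: exp_add)
  ultimately show "norm (nome_pow \<tau> (of_int (n\<^sup>2)) * exp (2 * of_int n * \<i> * z))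
      \<le> exp (B\<^sup>2 / (4 * A)) * exp (-1) ^ nat \<bar>n\<bar>"
    by (simp add: t)
qed

section \<open>Expanding products of theta functions over integer tuples\<close>

text \<open>The general term of the expanded product of the \<open>theta3 (w i) \<tau>\<close>. The
  index type is arbitrary so that a disjoint sum of two intervals can serve as
  \<open>I\<close>.\<close>

definition theta_tuple_term :: "complex \<Rightarrow> 'i set \<Rightarrow> ('i \<Rightarrow> complex) \<Rightarrow> ('i \<Rightarrow> int) \<Rightarrow> complex" where
  "theta_tuple_term \<tau> I w t =
     nome_pow \<tau> (of_int (\<Sum>i\<in>I. (t i)\<^sup>2)) * exp (2 * \<i> * (\<Sum>i\<in>I. of_int (t i) * w i))"

lemma theta_tuple_term_eq_prod:
  assumes "finite I"
  shows "theta_tuple_term \<tau> I w t =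
    (\<Prod>i\<in>I. nome_pow \<tau> (of_int ((t i)\<^sup>2)) * exp (2 * of_int (t i) * \<i> * w i))"
proof -
  have "nome_pow \<tau> (of_int (\<Sum>i\<in>I. (t i)\<^sup>2)) = (\<Prod>i\<in>I. nome_pow \<tau> (of_int ((t i)\<^sup>2)))"
    using assms by (simp add: nome_pow_def sum_distrib_left sum_distrib_right flip: exp_sum)
  moreover have "exp (2 * \<i> * (\<Sum>i\<in>I. of_int (t i) * w i)) = (\<Prod>i\<in>I. exp (2 * of_int (t i) * \<i> * w i))"
    using assms by (simp add: sum_distrib_left mult_ac flip: exp_sum)
  ultimately show ?thesis
    by (simp only: theta_tuple_term_def prod.distrib)
qed

lemma
  assumes "finite I" "Im \<tau> > 0"
  shows abs_summable_on_theta_tuple_term: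
      "(\<lambda>t. norm (theta_tuple_term \<tau> I w t)) summable_on (I \<rightarrow>\<^sub>E UNIV)"
    and prod_theta3_eq_infsum:
      "(\<Prod>i\<in>I. theta3 (w i) \<tau>) = infsum (theta_tuple_term \<tau> I w) (I \<rightarrow>\<^sub>E UNIV)"
proof -
  note eq = theta_tuple_term_eq_prod[OF assms(1), abs_def]
  show "(\<lambda>t. norm (theta_tuple_term \<tau> I w t)) summable_on (I \<rightarrow>\<^sub>E UNIV)"
    unfolding theta_tuple_term_eq_prod[OF assms(1)]
    by (rule abs_summable_on_prod_PiE[OF assms(1) abs_summable_on_theta3[OF assms(2)]])
  show "(\<Prod>i\<in>I. theta3 (w i) \<tau>) = infsum (theta_tuple_term \<tau> I w) (I \<rightarrow>\<^sub>E UNIV)"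
    unfolding eq theta3_def
    by (rule infsum_prod_PiE_abs[OF assms(1) abs_summable_on_theta3[OF assms(2)], symmetric])
qed

text \<open>A common translate sees a tuple only through its sum, so averaging over translates can
  select tuples by their sum.\<close>

lemma theta_tuple_term_translate:
  "theta_tuple_term \<tau> I (\<lambda>i. w i + c) t
    = theta_tuple_term \<tau> I w t * exp (2 * \<i> * of_int (sum t I) * c)"
proof -
  have "(\<Sum>i\<in>I. of_int (t i) * (w i + c)) = (\<Sum>i\<in>I. of_int (t i) * w i) + of_int (sum t I) * c"
    by (simp add: distrib_left sum.distrib sum_distrib_right)
  then show ?thesis
    by (simp add: theta_tuple_term_def distrib_left mult.assoc flip: exp_add)
qed

text \<open>The terms are the powers of an \<open>M\<close>-th root of unity \<open>u\<close>, so
  the geometric sum vanishes unless \<open>u = 1\<close>.\<close>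

lemma sum_exp_roots_of_unity:
  fixes T :: int
  assumes "M > 0"
  shows "(\<Sum>k<M. exp (2 * \<i> * of_int T * (of_nat k * of_real pi / of_nat M)))
    = (if int M dvd T then of_nat M else 0)"
proof -
  define u where "u = exp (2 * \<i> * of_int T * of_real pi / of_nat M)"
  have u: "exp (2 * \<i> * of_int T * (of_nat k * of_real pi / of_nat M)) = u ^ k" for k
    by (simp add: u_def field_simps flip: exp_of_nat_mult)
  have "u ^ M = exp (2 * of_real pi * \<i> * of_int T)"
    using assms by (simp add: u_def field_simps flip: exp_of_nat_mult)
  then have uM: "u ^ M = 1"
    by (simp add: exp_eq_1)
  have "u = 1 \<longleftrightarrow> (\<exists>n::int. 2 * of_int T * pi / of_nat M = of_int (2 * n) * pi)"
    by (simp add: u_def exp_eq_1)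
  also have "\<dots> \<longleftrightarrow> (\<exists>n::int. real_of_int T = of_int (int M * n))"
    using assms by (simp add: field_simps)
  also have "\<dots> \<longleftrightarrow> int M dvd T"
    by (simp only: of_int_eq_iff dvd_def)
  finally show ?thesis
    using uM unfolding u by (simp add: sum_gp_strict)
qed

text \<open>Summability is assumed for the joint family, since this is what transport along a
  bijection of index sets supplies.\<close>

lemma infsum_product:
  fixes f :: "'a \<Rightarrow> 'c :: {real_normed_field, banach}" and g :: "'b \<Rightarrow> 'c"
  assumes "(\<lambda>(x, y). f x * g y) summable_on A \<times> B"
  shows "(\<Sum>\<^sub>\<infinity>(x, y)\<in>A \<times> B. f x * g y) = infsum f A * infsum g B"
  using infsum_Sigma'_banach[OF assms]
  by (simp add: infsum_cmult_right' infsum_cmult_left')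

lemma infsum_sum:
  fixes f :: "'k \<Rightarrow> 'a \<Rightarrow> 'b :: {topological_comm_monoid_add, t2_space}"
  assumes "\<And>k. k \<in> K \<Longrightarrow> f k summable_on A"
  shows "(\<Sum>\<^sub>\<infinity>t\<in>A. \<Sum>k\<in>K. f k t) = (\<Sum>k\<in>K. infsum (f k) A)"
proof -
  have "((\<lambda>t. \<Sum>k\<in>K. f k t) has_sum (\<Sum>k\<in>K. infsum (f k) A)) A"
    using assms
    by (induction K rule: infinite_finite_induct) (auto intro!: has_sum_add)
  then show ?thesis by (rule infsumI)
qed

section \<open>Reduction to zero-sum tuples\<close>

lemma theta_tuple_term_shift:
  assumes "finite I" "sum t I = 0"
  shows "theta_tuple_term \<tau> I (\<lambda>i. z + w i) (\<lambda>i\<in>I. t i + of_nat m * l) =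
    nome_pow (of_nat (m\<^sup>2 * card I) * \<tau>) (of_int (l\<^sup>2)) *
      exp (2 * of_int l * \<i> * (of_nat (m * card I) * z + of_nat m * sum w I)) *
    theta_tuple_term \<tau> I w t"
proof -
  have sq: "(\<Sum>i\<in>I. (t i + int m * l)\<^sup>2) = (\<Sum>i\<in>I. (t i)\<^sup>2) + int (m\<^sup>2 * card I) * l\<^sup>2"
    using assms
    by (simp add: power2_sum sum.distrib power_mult_distrib flip: sum_distrib_left sum_distrib_right)
  \<comment> \<open>This is 0 for a zero-sum tuple, which makes the factor left for \<open>t\<close>
    independent of \<open>z\<close>.\<close>
  have "(\<Sum>i\<in>I. of_int (t i) * z) = of_int (sum t I) * z"
    by (simp add: sum_distrib_right)
  then have lin: "(\<Sum>i\<in>I. of_int (t i + int m * l) * (z + w i)) = (\<Sum>i\<in>I. of_int (t i) * w i)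
      + of_int l * (of_nat (m * card I) * z + of_nat m * sum w I)"
    using assms(2) by (simp add: algebra_simps sum.distrib flip: sum_distrib_left)
  have "theta_tuple_term \<tau> I (\<lambda>i. z + w i) (\<lambda>i\<in>I. t i + of_nat m * l) =
     nome_pow \<tau> (of_int (\<Sum>i\<in>I. (t i + int m * l)\<^sup>2)) *
      exp (2 * \<i> * (\<Sum>i\<in>I. of_int (t i + int m * l) * (z + w i)))"
    by (simp add: theta_tuple_term_def)
  also have "\<dots> = nome_pow (of_nat (m\<^sup>2 * card I) * \<tau>) (of_int (l\<^sup>2)) *
      exp (2 * of_int l * \<i> * (of_nat (m * card I) * z + of_nat m * sum w I)) *
    theta_tuple_term \<tau> I w t"
    unfolding sq lin theta_tuple_term_def nome_pow_def
    by (simp add: algebra_simps flip: exp_add)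
  finally show ?thesis .
qed

text \<open>The shift adds exactly \<open>m * card I * l\<close> to the sum, so division recovers
  \<open>l\<close>. Restricting to \<open>I\<close> keeps the shifted tuples extensional.\<close>

lemma bij_betw_shift_zero_sum:
  fixes I :: "'i set" and m :: nat
  assumes "finite I" "I \<noteq> {}" "m > 0"
  shows "bij_betw (\<lambda>(l, t). \<lambda>i\<in>I. t i + int m * l)
    (UNIV \<times> {t \<in> I \<rightarrow>\<^sub>E UNIV. sum t I = 0})
    {t \<in> I \<rightarrow>\<^sub>E UNIV. int (m * card I) dvd sum t I}"
proof (rule bij_betw_byWitness[where f' = "\<lambda>t. let l = sum t I div int (m * card I) in
      (l, \<lambda>i\<in>I. t i - int m * l)"]; (intro ballI subsetI)?)
  have pos: "int (m * card I) \<noteq> 0"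
    using assms by simp
  have sum: "(\<Sum>i\<in>I. t i + int m * l) = sum t I + int (m * card I) * l" for t l
    by (simp add: sum.distrib)
  fix p :: "int \<times> ('i \<Rightarrow> int)"
  assume p: "p \<in> UNIV \<times> {t \<in> I \<rightarrow>\<^sub>E UNIV. sum t I = 0}"
  obtain l t where [simp]: "p = (l, t)" by fastforce
  from p have t: "t \<in> extensional I" "sum t I = 0"
    by (auto simp: PiE_def)
  have "(\<Sum>i\<in>I. t i + int m * l) div int (m * card I) = l"
    unfolding sum using t pos by simp
  then show "(let l = sum (case p of (l, t) \<Rightarrow> \<lambda>i\<in>I. t i + int m * l) I div int (m * card I) in
      (l, \<lambda>i\<in>I. (case p of (l, t) \<Rightarrow> \<lambda>i\<in>I. t i + int m * l) i - int m * l)) = p"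
    using t by (auto simp: Let_def restrict_def extensional_def fun_eq_iff)
next
  fix t assume t: "t \<in> {t \<in> I \<rightarrow>\<^sub>E UNIV. int (m * card I) dvd sum t I}"
  show "(case let l = sum t I div int (m * card I) in (l, \<lambda>i\<in>I. t i - int m * l) of
      (l, t) \<Rightarrow> \<lambda>i\<in>I. t i + int m * l) = t"
    using t by (auto simp: Let_def restrict_def PiE_def extensional_def fun_eq_iff)
next
  fix u assume "u \<in> (\<lambda>(l, t). \<lambda>i\<in>I. t i + int m * l) ` (UNIV \<times> {t \<in> I \<rightarrow>\<^sub>E UNIV. sum t I = 0})"
  then show "u \<in> {t \<in> I \<rightarrow>\<^sub>E UNIV. int (m * card I) dvd sum t I}"
    by (auto simp: sum.distrib)
next
  fix p assume "p \<in> (\<lambda>t. let l = sum t I div int (m * card I) in (l, \<lambda>i\<in>I. t i - int m * l)) `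
    {t \<in> I \<rightarrow>\<^sub>E UNIV. int (m * card I) dvd sum t I}"
  then obtain t where t: "int (m * card I) dvd sum t I"
    and p: "p = (sum t I div int (m * card I), \<lambda>i\<in>I. t i - int m * (sum t I div int (m * card I)))"
    by (auto simp: Let_def)
  have "(\<Sum>i\<in>I. t i - int m * l) = sum t I - int (m * card I) * l" for l
    by (simp add: sum_subtractf)
  then have "(\<Sum>i\<in>I. t i - int m * (sum t I div int (m * card I))) = 0"
    using t by (simp only: dvd_mult_div_cancel diff_self)
  then show "p \<in> UNIV \<times> {t \<in> I \<rightarrow>\<^sub>E UNIV. sum t I = 0}"
    by (simp add: p)
qed

text \<open>The \<open>w i\<close> may have any sum: the half periods that turn
  \<open>theta4\<close> into \<open>theta3\<close> contribute to it, and it survives in the argument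
  of the last factor.\<close>

lemma sum_prod_theta3:
  fixes I :: "'i set" and m :: nat
  assumes "finite I" "I \<noteq> {}" "m > 0" and \<tau>: "Im \<tau> > 0"
  shows "(\<Sum>k<m * card I. \<Prod>i\<in>I. theta3 (z + w i + of_nat k * of_real pi / of_nat (m * card I)) \<tau>)
    = of_nat (m * card I) * infsum (theta_tuple_term \<tau> I w) {t \<in> I \<rightarrow>\<^sub>E UNIV. sum t I = 0}
      * theta3 (of_nat (m * card I) * z + of_nat m * sum w I) (of_nat (m\<^sup>2 * card I) * \<tau>)"
proof -
  define M where "M = m * card I"
  have M: "M > 0"
    using assms by (simp add: M_def card_gt_0_iff)
  define F where "F = theta_tuple_term \<tau> I (\<lambda>i. z + w i)"
  define e where "e k t = exp (2 * \<i> * of_int (sum t I) * (of_nat k * of_real pi / of_nat M))"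
    for k and t :: "'i \<Rightarrow> int"
  define D where "D = {t \<in> I \<rightarrow>\<^sub>E UNIV. int M dvd sum t I}"
  define Z where "Z = {t \<in> I \<rightarrow>\<^sub>E (UNIV :: int set). sum t I = 0}"
  define f where "f l = nome_pow (of_nat (m\<^sup>2 * card I) * \<tau>) (of_int (l\<^sup>2)) *
      exp (2 * of_int l * \<i> * (of_nat (m * card I) * z + of_nat m * sum w I))" for l
  have eq: "theta_tuple_term \<tau> I (\<lambda>i. z + w i + of_nat k * of_real pi / of_nat M)
      = (\<lambda>t. F t * e k t)" for k
    unfolding F_def e_def theta_tuple_term_translate ..
  have summ: "(\<lambda>t. F t * e k t) summable_on (I \<rightarrow>\<^sub>E UNIV)" for k
    unfolding eq[symmetric]
    by (rule abs_summable_summable[OF abs_summable_on_theta_tuple_term[OF assms(1) \<tau>]])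
  \<comment> \<open>\<open>e 0 t\<close> is 1, so \<open>k = 0\<close> gives the summability of
    \<open>F\<close> itself.\<close>
  have "F summable_on (I \<rightarrow>\<^sub>E UNIV)"
    using summ[of 0] by (simp add: e_def)
  then have "F summable_on D"
    by (rule summable_on_subset) (auto simp: D_def)
  have bij: "bij_betw (\<lambda>(l, t). \<lambda>i\<in>I. t i + int m * l) (UNIV \<times> Z) D"
    unfolding Z_def D_def M_def by (rule bij_betw_shift_zero_sum[OF assms(1-3)])
  have Fshift: "F (case p of (l, t) \<Rightarrow> \<lambda>i\<in>I. t i + int m * l)
      = (case p of (l, t) \<Rightarrow> f l * theta_tuple_term \<tau> I w t)" if "p \<in> UNIV \<times> Z" for p
    using that theta_tuple_term_shift[OF assms(1)] by (auto simp: F_def f_def Z_def)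
  have "(\<lambda>(l, t). f l * theta_tuple_term \<tau> I w t) summable_on UNIV \<times> Z"
    using \<open>F summable_on D\<close> unfolding summable_on_reindex_bij_betw[OF bij, symmetric]
    by (rule summable_on_cong[THEN iffD1, rotated]) (rule Fshift)
  then have "(\<Sum>\<^sub>\<infinity>(l, t)\<in>UNIV \<times> Z. f l * theta_tuple_term \<tau> I w t)
      = infsum f UNIV * infsum (theta_tuple_term \<tau> I w) Z"
    by (rule infsum_product)
  moreover have "infsum F D = (\<Sum>\<^sub>\<infinity>(l, t)\<in>UNIV \<times> Z. f l * theta_tuple_term \<tau> I w t)"
    unfolding infsum_reindex_bij_betw[OF bij, symmetric]
    by (rule infsum_cong) (rule Fshift)
  ultimately have FD: "infsum F D = infsum f UNIV * infsum (theta_tuple_term \<tau> I w) Z"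
    by simp
  have "(\<Sum>k<M. \<Prod>i\<in>I. theta3 (z + w i + of_nat k * of_real pi / of_nat M) \<tau>)
      = (\<Sum>k<M. \<Sum>\<^sub>\<infinity>t\<in>I \<rightarrow>\<^sub>E UNIV. F t * e k t)"
    unfolding prod_theta3_eq_infsum[OF assms(1) \<tau>] eq ..
  also have "\<dots> = (\<Sum>\<^sub>\<infinity>t\<in>I \<rightarrow>\<^sub>E UNIV. \<Sum>k<M. F t * e k t)"
    by (rule infsum_sum[symmetric]) (rule summ)
  \<comment> \<open>Summing the characters \<open>e k t\<close> over \<open>k\<close> gives
    \<open>M\<close> times the indicator of \<open>D\<close>.\<close>
  also have "\<dots> = (\<Sum>\<^sub>\<infinity>t\<in>I \<rightarrow>\<^sub>E UNIV. F t * (if int M dvd sum t I then of_nat M else 0))"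
    unfolding e_def sum_distrib_left[symmetric] sum_exp_roots_of_unity[OF M] ..
  also have "\<dots> = (\<Sum>\<^sub>\<infinity>t\<in>D. of_nat M * F t)"
    by (rule infsum_cong_neutral) (auto simp: D_def)
  also have "\<dots> = of_nat M * infsum F D"
    by (rule infsum_cmult_right')
  finally show ?thesis
    unfolding FD f_def Z_def M_def theta3_def by (simp add: mult_ac)
qed

section \<open>Half-period translates and mixed products\<close>

lemma exp_i_pi_of_int: "exp (\<i> * of_real pi * of_int n) = (-1) powi n"
proof -
  have "exp (\<i> * of_real pi) powi n = exp (of_int n * (\<i> * of_real pi))"
    by (rule exp_power_int)
  then show ?thesis
    by (simp add: mult_ac)
qed

text \<open>The translate multiplies the \<open>n\<close>-th term by \<open>(-1)\<close> to the
  power \<open>k * n\<close>. The case \<open>k = 1\<close> removes \<open>theta4\<close> from the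
  products; \<open>k = m * b\<close> yields the final parity distinction.\<close>

lemma theta3_add_half_pi_mult:
  "theta3 (z + of_nat k * of_real pi / 2) \<tau> = (if even k then theta3 z \<tau> else theta4 z \<tau>)"
proof -
  have "exp (2 * of_int n * \<i> * (z + of_nat k * of_real pi / 2))
      = ((-1) ^ k) powi n * exp (2 * of_int n * \<i> * z)" for n
  proof -
    have "2 * of_int n * \<i> * (z + of_nat k * of_real pi / 2)
        = \<i> * of_real pi * of_int (int k * n) + 2 * of_int n * \<i> * z"
      by (simp add: algebra_simps)
    then have "exp (2 * of_int n * \<i> * (z + of_nat k * of_real pi / 2))
        = (-1) powi (int k * n) * exp (2 * of_int n * \<i> * z)"
      by (simp only: exp_add exp_i_pi_of_int)
    then show ?thesis
      by (simp add: power_int_mult)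
  qed
  then show ?thesis
    by (simp add: theta3_def theta4_def mult_ac)
qed

lemma theta4_eq_theta3: "theta4 z \<tau> = theta3 (z + of_real pi / 2) \<tau>"
  using theta3_add_half_pi_mult[of z 1 \<tau>] by simp

text \<open>A pair \<open>(r, s)\<close> is the same as one function on the disjoint sum, which
  brings the index set of \<open>R34\<close> into the form of the uniform \<open>theta3\<close>
  formula.\<close>

lemma infsum_zero_sum_tuples:
  "(\<Sum>\<^sub>\<infinity>(r, s)\<in>zero_sum_tuples a b. g (case_sum r s))
     = infsum g {t \<in> {1..a} <+> {1..b} \<rightarrow>\<^sub>E UNIV. sum t ({1..a} <+> {1..b}) = 0}"
proof -
  let ?Z = "{t \<in> {1..a} <+> {1..b} \<rightarrow>\<^sub>E (UNIV :: int set). sum t ({1..a} <+> {1..b}) = 0}"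
  have "bij_betw (\<lambda>(r, s). case_sum r s) (zero_sum_tuples a b) ?Z"
  proof (rule bij_betw_byWitness[where f' = "\<lambda>t. (t \<circ> Inl, t \<circ> Inr)"])
    show "(\<lambda>(r, s). case_sum r s) ` zero_sum_tuples a b \<subseteq> ?Z"
    proof (clarsimp simp: zero_sum_tuples_def PiE_def sum.Plus simp del: One_nat_def)
      fix r s :: "nat \<Rightarrow> int"
      assume "r \<in> extensional {1..a}" "s \<in> extensional {1..b}"
      then have "case_sum r s v = undefined" if "v \<notin> {1..a} <+> {1..b}" for v
        using that by (cases v) (auto simp: extensional_def)
      then show "case_sum r s \<in> extensional ({1..a} <+> {1..b})"
        by (simp add: extensional_def)
    qed
    show "(\<lambda>t. (t \<circ> Inl, t \<circ> Inr)) ` ?Z \<subseteq> zero_sum_tuples a b"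
    proof (clarsimp simp: zero_sum_tuples_def PiE_def sum.Plus simp del: One_nat_def)
      fix t :: "nat + nat \<Rightarrow> int"
      assume t: "t \<in> extensional ({1..a} <+> {1..b})"
      show "t \<circ> Inl \<in> extensional {1..a} \<and> t \<circ> Inr \<in> extensional {1..b}"
        by (auto simp: extensional_def intro!: extensional_arb[OF t])
    qed
    show "\<forall>t\<in>?Z. (case (t \<circ> Inl, t \<circ> Inr) of (r, s) \<Rightarrow> case_sum r s) = t"
      by (auto intro!: ext split: sum.split)
  qed (auto simp: case_sum_o_inj)
  from infsum_reindex_bij_betw[OF this, of g] show ?thesis
    by (simp add: case_prod_unfold)
qed

theorem theorem1p13:
  fixes m n a b :: nat and x y :: "nat \<Rightarrow> complex" and \<tau> z :: complex
  assumes "Im \<tau> > 0"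
    and "m > 0" and "n > 0" and "a + b = n"
    and "(\<Sum>j=1..a. x j) + (\<Sum>i=1..b. y i) = 0"
  shows "(even (m * b) \<longrightarrow>
            S34 m n a b x y \<tau> z
              = R34 m n a b x y \<tau> * theta3 (of_nat (m * n) * z) (of_nat (m\<^sup>2 * n) * \<tau>))
       \<and> (odd (m * b) \<longrightarrow>
            S34 m n a b x y \<tau> z
              = R34 m n a b x y \<tau> * theta4 (of_nat (m * n) * z) (of_nat (m\<^sup>2 * n) * \<tau>))"
proof -
  let ?I = "{1..a} <+> {1..b}"
  define w where "w = case_sum x (\<lambda>i. y i + of_real pi / 2)"
  have card: "card ?I = n"
    using assms(4) by (simp add: card_Plus)
  \<comment> \<open>Infinite and empty sets have cardinality 0, whereas
    \<open>n > 0\<close>.\<close>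
  then have I: "finite ?I" "?I \<noteq> {}"
    using assms(3) by (metis card.infinite less_irrefl, metis card.empty less_irrefl)
  \<comment> \<open>The \<open>x j\<close> and \<open>y i\<close> cancel; one half period remains
    for each \<open>theta4\<close>.\<close>
  have sum_w: "sum w ?I = of_nat b * of_real pi / 2"
    using assms(5) by (simp add: w_def sum.Plus sum.distrib flip: add.assoc)
  have comm: "z + v + c + d = z + (v + d) + c" for v c d :: complex
    by simp
  have S: "S34 m n a b x y \<tau> z
      = (\<Sum>k<m * n. \<Prod>i\<in>?I. theta3 (z + w i + of_nat k * of_real pi / of_nat (m * n)) \<tau>)"
    by (simp add: S34_def w_def prod.Plus theta4_eq_theta3 comm)
  have R: "R34 m n a b x y \<tau>
      = of_nat (m * n) * infsum (theta_tuple_term \<tau> ?I w) {t \<in> ?I \<rightarrow>\<^sub>E UNIV. sum t ?I = 0}"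
  proof -
    have "(-1) powi (\<Sum>i=1..b. s i)
        * nome_pow \<tau> (of_int ((\<Sum>j=1..a. (r j)\<^sup>2) + (\<Sum>i=1..b. (s i)\<^sup>2)))
        * exp (2 * \<i> * ((\<Sum>j=1..a. of_int (r j) * x j) + (\<Sum>i=1..b. of_int (s i) * y i)))
        = theta_tuple_term \<tau> ?I w (case_sum r s)" for r s :: "nat \<Rightarrow> int"
    proof -
      \<comment> \<open>The half period attached to \<open>y i\<close> contributes
        \<open>\<i> * pi * s i\<close>, the source of the sign in \<open>R34\<close>.\<close>
      have "2 * \<i> * (\<Sum>i\<in>?I. of_int (case_sum r s i) * w i) = \<i> * of_real pi * of_int (\<Sum>i=1..b. s i)
        + 2 * \<i> * ((\<Sum>j=1..a. of_int (r j) * x j) + (\<Sum>i=1..b. of_int (s i) * y i))"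
        by (simp add: w_def sum.Plus distrib_left sum.distrib
            flip: sum_distrib_right sum_divide_distrib)
      then have "exp (2 * \<i> * (\<Sum>i\<in>?I. of_int (case_sum r s i) * w i))
        = (-1) powi (\<Sum>i=1..b. s i)
          * exp (2 * \<i> * ((\<Sum>j=1..a. of_int (r j) * x j) + (\<Sum>i=1..b. of_int (s i) * y i)))"
        by (simp only: exp_add exp_i_pi_of_int)
      then show ?thesis
        by (simp add: theta_tuple_term_def sum.Plus)
    qed
    then show ?thesis
      unfolding R34_def infsum_zero_sum_tuples[symmetric] by simp
  qed
  have "of_nat m * sum w ?I = of_nat (m * b) * of_real pi / 2"
    unfolding sum_w by simp
  then have "S34 m n a b x y \<tau> z = R34 m n a b x y \<tau> *
      theta3 (of_nat (m * n) * z + of_nat (m * b) * of_real pi / 2) (of_nat (m\<^sup>2 * n) * \<tau>)"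
    using sum_prod_theta3[OF I assms(2,1), of z w] by (simp only: card S R)
  then show ?thesis
    by (cases "even (m * b)") (simp_all only: theta3_add_half_pi_mult if_True if_False simp_thms)
qed

end
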